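(* Let $Q\in\mathbb{R}^{n\times n}$ be symmetric positive definite, let $b\in\mathbb{R}^n$, and let $F:\mathbb{R}^n\to\mathbb{R}^n$ be the mapping $F(x)=x-(Qx-b)$, with unique fixed point $x^*=Q^{-1}b$. Let $P\geq 1$ and let $p_1,\dots,p_P$ be any integers with $p_j\geq 2$ for all $j$. Then, for every starting point $x_0\in\mathbb{R}^n$, the sequence $\{x_k\}_{k\ge 0}$ generated by the ACX$^{p_1,\dots,p_P}$ method applied to $F$ converges Q-linearly to $x^*$ in the norm $\|\cdot\|_{Q^{-1}}$; that is, there exists a constant $r\in[0,1)$ such that $$\|x_{k+1}-x^*\|_{Q^{-1}}\leq r\,\|x_k-x^*\|_{Q^{-1}}\qquad\text{for all } k\geq 0.$$
   Context: Norm: for symmetric positive definite $Q$, $\|x\|_{Q^{-1}}=\sqrt{x^{\intercal}Q^{-1}x}$. Differences: for a mapping $F:\mathbb{R}^n\to\mathbb{R}^n$ and $x\in\mathbb{R}^n$, set $\Delta^0x=x$, $\Delta^1 x=\Delta x=F(x)-x$, and recursively $\Delta^{p}x=\Delta^{p-1}F(x)-\Delta^{p-1}x$, where $\Delta^{p-1}F(x)$ means the difference $\Delta^{p-1}$ evaluated at the point $F(x)$. Equivalently, $\Delta^p x=\sum_{i=0}^p(-1)^{p-i}\binom{p}{i}F^i(x)$, where $F^i$ is the $i$-fold composition of $F$. ACX method: given orders $p_1,\dots,p_P$ (integers $\geq 2$) and a starting point $x_0$, at iteration $k=0,1,2,\dots$ use the order $p=p_{(k \bmod P)+1}$ (the orders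 are used cyclically), compute the step length $$\sigma_k^{(p)}=\frac{|\langle\Delta^{p}x_k,\Delta^{p-1}x_k\rangle|}{\|\Delta^{p}x_k\|^2},$$ where $\langle y,z\rangle=y^{\intercal}z$ and $\|\cdot\|$ is the Euclidean norm, and set $$x_{k+1}=\sum_{i=0}^{p}\binom{p}{i}\bigl(\sigma_k^{(p)}\bigr)^i\,\Delta^i x_k .$$ If $x_k$ is already the fixed point $x^*$ (so that $\Delta^p x_k=0$ and the step length is undefined), the method has converged and one sets $x_{k+1}=x_k$. *)

theory Defs
  imports "HOL-Analysis.Analysis"
begin

definition sym_pos_def :: "real^'n^'n \<Rightarrow> bool" where
  "sym_pos_def Q \<longleftrightarrow> transpose Q = Q \<and> (\<forall>x. x \<noteq> 0 \<longrightarrow> x \<bullet> (Q *v x) > 0)"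

definition inv_norm :: "real^'n^'n \<Rightarrow> real^'n \<Rightarrow> real" where
  "inv_norm Q x = sqrt (x \<bullet> (matrix_inv Q *v x))"

primrec Delta :: "('a \<Rightarrow> 'a) \<Rightarrow> nat \<Rightarrow> 'a \<Rightarrow> 'a::real_inner" where
  "Delta F 0 x = x"
| "Delta F (Suc p) x = Delta F p (F x) - Delta F p x"

definition acx_steplength :: "('a \<Rightarrow> 'a) \<Rightarrow> nat \<Rightarrow> 'a::real_inner \<Rightarrow> real" where
  "acx_steplength F p x = \<bar>Delta F p x \<bullet> Delta F (p - 1) x\<bar> / (norm (Delta F p x))\<^sup>2"

definition acx_step :: "('a \<Rightarrow> 'a) \<Rightarrow> nat \<Rightarrow> 'a \<Rightarrow> 'a::real_inner" where
  "acx_step F p x =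
     (if F x = x then x
      else (\<Sum>i=0..p. (real (p choose i) * acx_steplength F p x ^ i) *\<^sub>R Delta F i x))"

(* The list ps holds the orders p_1, ..., p_P and is indexed from 0, so that
   iteration k uses p_((k mod P) + 1) = ps ! (k mod P). *)
primrec acx :: "('a \<Rightarrow> 'a) \<Rightarrow> nat list \<Rightarrow> 'a \<Rightarrow> nat \<Rightarrow> 'a::real_inner" where
  "acx F ps x0 0 = x0"
| "acx F ps x0 (Suc k) = acx_step F (ps ! (k mod length ps)) (acx F ps x0 k)"

end

theory Submission
  imports Defs
begin

text \<open>
  In an orthonormal eigenbasis of \<open>Q\<close> the error coordinate for the eigenvalue \<open>\<lambda>\<close>
  is multiplied by \<open>(1 - \<sigma> \<lambda>)\<^sup>p\<close> in one step.  Single coordinates may grow, but with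
  \<open>s = \<sigma> \<lambda>\<close> the scalar inequality \<open>(1 - s)\<^sup>2\<^sup>p \<le> 1 + s\<^sup>2\<^sup>p (s - 1) - min s 1\<close> holds
  for \<open>s > 0\<close>, and the choice of the step length makes the average of \<open>s\<^sup>2\<^sup>p (s - 1)\<close>
  over the squared coordinates in the norm of \<open>Q\<^sup>-\<^sup>1\<close> vanish.  Since
  \<open>\<sigma> \<ge> 1 / \<lambda>\<^sub>m\<^sub>a\<^sub>x\<close>, this gives the rate
  \<open>r\<^sup>2 = 1 - \<lambda>\<^sub>m\<^sub>i\<^sub>n / \<lambda>\<^sub>m\<^sub>a\<^sub>x\<close>, whatever the orders are.
\<close>

section \<open>The spectral theorem for self-adjoint operators\<close>

text \<open>First-order optimality without derivatives: a positive linear coefficient would beat the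
  quadratic term for small \<open>t\<close>. The witness is \<open>t = a / D\<close> with
  \<open>D\<close> positive and above \<open>C\<close>.\<close>

lemma linear_upper_quadratic_imp_zero:
  fixes a C :: real
  assumes "0 \<le> a" and "\<And>t. 2 * t * a \<le> t\<^sup>2 * C"
  shows "a = 0"
proof (rule ccontr)
  assume "a \<noteq> 0"
  with assms(1) have "a > 0" by simp
  define D where "D = \<bar>C\<bar> + 1"
  have "D > 0" "C < D" by (auto simp: D_def)
  have "2 * (a / D) * a \<le> (a / D)\<^sup>2 * C" by (rule assms(2))
  also have "\<dots> \<le> (a / D)\<^sup>2 * D" using \<open>C < D\<close> by (intro mult_left_mono) auto
  also have "\<dots> = (a / D) * a" using \<open>D > 0\<close> by (simp add: power2_eq_square)
  finally have "(a / D) * a \<le> 0" by simp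
  with \<open>a > 0\<close> \<open>D > 0\<close> show False
    by (meson divide_pos_pos linorder_not_less mult_pos_pos)
qed

text \<open>A maximiser of the Rayleigh quotient on an invariant subspace is an eigenvector.\<close>

lemma self_adjoint_eigenvector_exists:
  fixes f :: "'a::euclidean_space \<Rightarrow> 'a"
  assumes lin: "linear f" and adj: "\<And>x y. f x \<bullet> y = x \<bullet> f y"
    and S: "subspace S" "f ` S \<subseteq> S" "S \<noteq> {0}"
  obtains u l where "u \<in> S" "norm u = 1" "f u = l *\<^sub>R u"
proof -
  define K where "K = S \<inter> sphere 0 1"
  have "compact K" unfolding K_def
    using S(1) by (intro closed_Int_compact closed_subspace) auto
  moreover obtain y where y: "y \<in> S" "y \<noteq> 0"
    using S subspace_0 by blast
  have "(1 / norm y) *\<^sub>R y \<in> K"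
    using y S(1) by (auto simp: K_def subspace_scale)
  hence "K \<noteq> {}" by blast
  moreover have "continuous_on K (\<lambda>x. x \<bullet> f x)"
    by (intro continuous_intros linear_continuous_on linear_conv_bounded_linear[THEN iffD1] lin)
  ultimately obtain u where u: "u \<in> K" and max: "\<And>y. y \<in> K \<Longrightarrow> y \<bullet> f y \<le> u \<bullet> f u"
    using continuous_attains_sup[of K "\<lambda>x. x \<bullet> f x"] by blast
  define l where "l = u \<bullet> f u"
  define w where "w = f u - l *\<^sub>R u"
  have uS: "u \<in> S" and nu: "norm u = 1" using u by (auto simp: K_def)
  have uu: "u \<bullet> u = 1" using nu by (simp add: norm_eq_1)
  have wS: "w \<in> S" unfolding w_def
    using S uS by (intro subspace_diff subspace_scale) auto
  \<comment> \<open>Homogeneous form of maximality, so that perturbations of \<open>u\<close> need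
    not be normalised.\<close>
  have le: "y \<bullet> f y \<le> l * (y \<bullet> y)" if "y \<in> S" for y
  proof (cases "y = 0")
    case True
    thus ?thesis by simp
  next
    case False
    define z where "z = (1 / norm y) *\<^sub>R y"
    have "z \<in> K" using that S(1) False by (auto simp: z_def K_def subspace_scale)
    from max[OF this] have "(y \<bullet> f y) / (norm y)\<^sup>2 \<le> l"
      by (simp add: z_def l_def linear_cmul[OF lin] power2_eq_square)
    thus ?thesis using False by (simp add: divide_le_eq dot_square_norm)
  qed
  have wu: "w \<bullet> u = 0" by (simp add: w_def inner_diff_left uu l_def adj)
  have wfu: "w \<bullet> f u = w \<bullet> w"
    using wu by (simp add: w_def inner_diff_right)
  \<comment> \<open>Perturb \<open>u\<close> along the residual \<open>w\<close>, which stays in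
    \<open>S\<close>: the constant terms cancel and the linear term in \<open>t\<close> is
    \<open>2 * t * (w \<bullet> w)\<close>.\<close>
  have "w \<bullet> w = 0"
  proof (rule linear_upper_quadratic_imp_zero)
    fix t :: real
    have "(u + t *\<^sub>R w) \<bullet> f (u + t *\<^sub>R w) \<le> l * ((u + t *\<^sub>R w) \<bullet> (u + t *\<^sub>R w))"
      using S(1) uS wS by (intro le subspace_add subspace_scale)
    moreover have "u \<bullet> f w = w \<bullet> w"
      using wfu adj[of u w] by (simp add: inner_commute)
    ultimately show "2 * t * (w \<bullet> w) \<le> t\<^sup>2 * (l * (w \<bullet> w) - w \<bullet> f w)"
      using wu wfu uu
      by (simp add: linear_add[OF lin] linear_cmul[OF lin] inner_add_left inner_add_right
          inner_commute[of u w] l_def[symmetric] algebra_simps power2_eq_square)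
  qed simp
  hence "f u = l *\<^sub>R u" by (simp add: w_def)
  with uS nu show thesis by (rule that)
qed

text \<open>Induction on the dimension: split off a unit eigenvector \<open>u\<close> of
  \<open>S\<close>. Self-adjointness makes the orthogonal complement of \<open>u\<close> in
  \<open>S\<close> invariant again, so the claim is stated for invariant subspaces.\<close>

lemma self_adjoint_orthonormal_eigenbasis_on:
  fixes f :: "'a::euclidean_space \<Rightarrow> 'a"
  assumes lin: "linear f" and adj: "\<And>x y. f x \<bullet> y = x \<bullet> f y"
    and "subspace S" "f ` S \<subseteq> S"
  shows "\<exists>B. pairwise orthogonal B \<and> (\<forall>u\<in>B. norm u = 1 \<and> (\<exists>l. f u = l *\<^sub>R u)) \<and> span B = S"
  using assms(3,4)
proof (induction "dim S" arbitrary: S rule: less_induct)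
  case less
  show ?case
  proof (cases "S = {0}")
    case True
    thus ?thesis by (intro exI[of _ "{}"]) auto
  next
    case False
    from self_adjoint_eigenvector_exists[OF lin adj less.prems this]
    obtain u l where u: "u \<in> S" "norm u = 1" "f u = l *\<^sub>R u" by metis
    have uu: "u \<bullet> u = 1" using u(2) by (simp add: norm_eq_1)
    define T where "T = S \<inter> {x. u \<bullet> x = 0}"
    have T: "subspace T" unfolding T_def
      using less.prems(1) by (intro subspace_inter subspace_hyperplane)
    have "u \<notin> T" using uu by (simp add: T_def)
    hence "T \<noteq> S" using u(1) by blast
    hence "T \<subset> S" by (auto simp: T_def)
    hence "dim T < dim S"
      using T less.prems(1) by (intro dim_psubset) (simp add: span_eq_iff[THEN iffD2])
    moreover have "f ` T \<subseteq> T"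
      using less.prems(2) by (auto simp: T_def adj[symmetric] u(3))
    ultimately obtain B where B: "pairwise orthogonal B" "span B = T"
      "\<forall>u\<in>B. norm u = 1 \<and> (\<exists>l. f u = l *\<^sub>R u)"
      using less.hyps[OF _ T] by blast
    have BT: "B \<subseteq> T" using B(2) span_superset by blast
    have "pairwise orthogonal (insert u B)"
      using B(1) BT by (auto simp: pairwise_insert T_def orthogonal_def inner_commute)
    moreover have "span (insert u B) = S"
    proof
      show "span (insert u B) \<subseteq> S"
        using BT u(1) less.prems(1) by (intro span_minimal) (auto simp: T_def)
      show "S \<subseteq> span (insert u B)"
      proof
        fix x assume "x \<in> S"
        hence "x - (u \<bullet> x) *\<^sub>R u \<in> T"
          using u(1) uu less.prems(1)
          by (auto simp: T_def inner_diff_right intro!: subspace_diff subspace_scale)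
        thus "x \<in> span (insert u B)" using B(2) by (auto simp: span_insert)
      qed
    qed
    ultimately show ?thesis using u B(3) by (intro exI[of _ "insert u B"]) auto
  qed
qed

corollary self_adjoint_orthonormal_eigenbasis:
  fixes f :: "'a::euclidean_space \<Rightarrow> 'a"
  assumes "linear f" and "\<And>x y. f x \<bullet> y = x \<bullet> f y"
  obtains B lam where "pairwise orthogonal B" "\<And>u. u \<in> B \<Longrightarrow> norm u = 1"
    "\<And>u. u \<in> B \<Longrightarrow> f u = lam u *\<^sub>R u" "span B = UNIV"
  using self_adjoint_orthonormal_eigenbasis_on[OF assms subspace_UNIV] by (metis subset_UNIV)

text \<open>Parseval's identity, from expanding \<open>y\<close> in \<open>B\<close>.\<close>

lemma inner_orthonormal_basis:
  fixes x y :: "'a::euclidean_space"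
  assumes "pairwise orthogonal B" "\<And>u. u \<in> B \<Longrightarrow> norm u = 1" "span B = UNIV"
  shows "x \<bullet> y = (\<Sum>u\<in>B. (x \<bullet> u) * (y \<bullet> u))"
proof -
  have fin: "finite B" by (rule pairwise_orthogonal_imp_finite[OF assms(1)])
  have "x \<bullet> y = x \<bullet> (\<Sum>u\<in>B. (y \<bullet> u) *\<^sub>R u)"
    using orthonormal_basis_expand[OF assms(1,2) _ fin, of y] assms(3) by simp
  thus ?thesis by (simp add: inner_sum_right mult.commute)
qed

section \<open>The weighted contraction estimate\<close>

text \<open>At exponent 2, \<open>(1 - s)\<^sup>2 = 1 - s + s * (s - 1)\<close>; for
  \<open>s \<le> 1\<close> higher powers shrink the left side and make the nonpositive last term
  less negative. For \<open>s > 1\<close> the right side is \<open>s ^ (2 * p) * (s - 1)\<close>,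
  and the cases differ in whether \<open>s - 1\<close> exceeds 1.\<close>

lemma one_minus_even_power_bound:
  fixes s :: real
  assumes "0 < s" "1 \<le> p"
  shows "(1 - s) ^ (2 * p) \<le> 1 + s ^ (2 * p) * (s - 1) - min s 1"
proof -
  consider "s \<le> 1" | "1 < s" "s \<le> 2" | "2 < s" by linarith
  thus ?thesis
  proof cases
    case 1
    have "(1 - s) ^ (2 * p) \<le> (1 - s) ^ 2"
      using assms 1 by (intro power_decreasing) auto
    also have "\<dots> \<le> 1 - s + s ^ 1 * (s - 1)" by (simp add: power2_eq_square algebra_simps)
    also have "s ^ 1 * (s - 1) \<le> s ^ (2 * p) * (s - 1)"
      using assms 1 by (intro mult_right_mono_neg power_decreasing) auto
    finally show ?thesis using 1 by simp
  next
    case 2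
    have "(1 - s) ^ (2 * p) = (s - 1) ^ (2 * p)" by (simp add: power_mult power2_commute)
    also have "\<dots> \<le> (s - 1) ^ 1"
      using assms 2 by (intro power_decreasing) auto
    also have "\<dots> \<le> s ^ (2 * p) * (s - 1)"
      using 2 one_le_power[of s "2 * p"] by simp
    finally show ?thesis using 2 by simp
  next
    case 3
    have "(1 - s) ^ (2 * p) = (s - 1) ^ (2 * p)" by (simp add: power_mult power2_commute)
    also have "\<dots> \<le> s ^ (2 * p) * 1"
      using 3 by (simp add: power_mono)
    also have "\<dots> \<le> s ^ (2 * p) * (s - 1)"
      using 3 by (intro mult_left_mono) auto
    finally show ?thesis using 3 by simp
  qed
qed

lemma weighted_contraction:
  fixes w lam :: "'a \<Rightarrow> real"
  assumes "finite B" "1 \<le> p" "0 < m"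
    and w: "\<And>u. u \<in> B \<Longrightarrow> 0 \<le> w u"
    and lam: "\<And>u. u \<in> B \<Longrightarrow> m \<le> lam u" "\<And>u. u \<in> B \<Longrightarrow> lam u \<le> M"
    and pos: "0 < (\<Sum>u\<in>B. w u * lam u ^ (2 * p + 1))"
    and \<sigma>: "\<sigma> = (\<Sum>u\<in>B. w u * lam u ^ (2 * p)) / (\<Sum>u\<in>B. w u * lam u ^ (2 * p + 1))"
  shows "(\<Sum>u\<in>B. w u * (1 - \<sigma> * lam u) ^ (2 * p)) \<le> (1 - m / M) * (\<Sum>u\<in>B. w u)"
proof -
  define A where "A = (\<Sum>u\<in>B. w u * lam u ^ (2 * p))"
  define D where "D = (\<Sum>u\<in>B. w u * lam u ^ (2 * p + 1))"
  have lam0: "0 < lam u" if "u \<in> B" for u using lam(1)[OF that] assms(3) by simp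
  have "B \<noteq> {}" using pos by auto
  then obtain v where v: "v \<in> B" by blast
  have M: "0 < M" "m \<le> M" using lam[OF v] assms(3) by auto
  have "D \<le> M * A"
    unfolding A_def D_def sum_distrib_left
  proof (rule sum_mono)
    fix u assume u: "u \<in> B"
    have "lam u * (w u * lam u ^ (2 * p)) \<le> M * (w u * lam u ^ (2 * p))"
      using w[OF u] lam0[OF u] lam(2)[OF u] by (intro mult_right_mono) auto
    thus "w u * lam u ^ (2 * p + 1) \<le> M * (w u * lam u ^ (2 * p))" by (simp add: mult_ac)
  qed
  moreover have "0 < D" using pos by (simp only: D_def)
  ultimately have "1 / M \<le> A / D" using M(1) by (simp add: divide_simps mult.commute)
  hence sM: "1 / M \<le> \<sigma>" by (simp only: \<sigma> A_def D_def)
  hence s0: "0 < \<sigma>" using M by (meson less_le_trans zero_less_divide_1_iff)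
  have "(\<Sum>u\<in>B. w u * (1 - \<sigma> * lam u) ^ (2 * p)) \<le>
      (\<Sum>u\<in>B. w u * (1 - m / M) + \<sigma> ^ (2 * p) * (\<sigma> * (w u * lam u ^ (2 * p + 1))
        - w u * lam u ^ (2 * p)))"
  proof (rule sum_mono)
    fix u assume u: "u \<in> B"
    define s where "s = \<sigma> * lam u"
    have "m / M \<le> s"
      using mult_mono[OF sM lam(1)[OF u]] s0 assms(3) by (simp add: s_def)
    moreover have "m / M \<le> 1" using M by simp
    moreover have "0 < s" using s0 lam0[OF u] by (simp add: s_def)
    \<comment> \<open>Both arguments of \<open>min s 1\<close> are at least
      \<open>m / M\<close>.\<close>
    ultimately have "(1 - s) ^ (2 * p) \<le> (1 - m / M) + s ^ (2 * p) * (s - 1)"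
      using one_minus_even_power_bound[of s p] assms(2) by linarith
    hence "w u * (1 - s) ^ (2 * p) \<le> w u * ((1 - m / M) + s ^ (2 * p) * (s - 1))"
      using w[OF u] by (rule mult_left_mono)
    also have "\<dots> = w u * (1 - m / M) + \<sigma> ^ (2 * p) * (\<sigma> * (w u * lam u ^ (2 * p + 1))
        - w u * lam u ^ (2 * p))"
      by (simp add: s_def algebra_simps power_mult_distrib)
    finally show "w u * (1 - \<sigma> * lam u) ^ (2 * p) \<le> \<dots>" unfolding s_def .
  qed
  also have "\<dots> = (1 - m / M) * (\<Sum>u\<in>B. w u) + \<sigma> ^ (2 * p) * (\<sigma> * D - A)"
    by (simp add: sum.distrib sum_subtractf sum_distrib_left[symmetric]
        sum_distrib_right[symmetric] A_def D_def)
  \<comment> \<open>The step length is exactly the root of this linear expression.\<close>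
  also have "\<sigma> * D - A = 0"
    using pos by (simp add: \<sigma> A_def D_def)
  finally show ?thesis by simp
qed

section \<open>The iteration in eigencoordinates\<close>

text \<open>\<open>F\<close> scales the error along \<open>u\<close> by \<open>1 - l\<close>, so
  each difference contributes the factor \<open>(1 - l) - 1 = - l\<close>. Order 0 is excluded
  because \<open>Delta F 0 x\<close> is \<open>x\<close> and not \<open>x - z\<close>.\<close>

lemma Delta_inner_eigenvector:
  fixes F :: "'a::real_inner \<Rightarrow> 'a"
  assumes "\<And>x. (F x - z) \<bullet> u = (1 - l) * ((x - z) \<bullet> u)"
  shows "Delta F (Suc p) x \<bullet> u = (- l) ^ Suc p * ((x - z) \<bullet> u)"
proof (induction p arbitrary: x)
  case 0
  show ?case using assms[of x] by (simp add: inner_diff_left algebra_simps)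
next
  case (Suc p)
  have "Delta F (Suc (Suc p)) x \<bullet> u = Delta F (Suc p) (F x) \<bullet> u - Delta F (Suc p) x \<bullet> u"
    by (simp only: Delta.simps(2)[of F "Suc p"] inner_diff_left)
  also have "\<dots> = (- l) ^ Suc p * ((1 - l) * ((x - z) \<bullet> u)) - (- l) ^ Suc p * ((x - z) \<bullet> u)"
    by (simp only: Suc.IH assms)
  finally show ?case by (simp add: algebra_simps)
qed

text \<open>The binomial theorem in one coordinate, for an arbitrary \<open>\<sigma>\<close>. The
  term \<open>i = 0\<close> carries an extra \<open>z \<bullet> u\<close>, which subtracting
  \<open>z\<close> removes.\<close>

lemma Delta_sum_inner_eigenvector:
  fixes F :: "'a::real_inner \<Rightarrow> 'a"
  assumes "\<And>x. (F x - z) \<bullet> u = (1 - l) * ((x - z) \<bullet> u)"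
  shows "((\<Sum>i=0..p. (real (p choose i) * \<sigma> ^ i) *\<^sub>R Delta F i x) - z) \<bullet> u
    = (1 - \<sigma> * l) ^ p * ((x - z) \<bullet> u)"
proof -
  have D: "Delta F i x \<bullet> u = (- l) ^ i * ((x - z) \<bullet> u) + (if i = 0 then z \<bullet> u else 0)" for i
    using Delta_inner_eigenvector[OF assms] by (cases i) (auto simp: inner_diff_left)
  have pw: "(- (\<sigma> * l)) ^ i = \<sigma> ^ i * (- l) ^ i" for i
    by (simp flip: power_mult_distrib)
  have "(\<Sum>i=0..p. (real (p choose i) * \<sigma> ^ i) *\<^sub>R Delta F i x) \<bullet> u
    = (\<Sum>i=0..p. real (p choose i) * (- (\<sigma> * l)) ^ i * ((x - z) \<bullet> u)
        + (if i = 0 then z \<bullet> u else 0))"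
    unfolding inner_sum_left
    by (intro sum.cong refl) (simp add: D pw distrib_left)
  also have "\<dots> = (\<Sum>i\<le>p. real (p choose i) * (- (\<sigma> * l)) ^ i) * ((x - z) \<bullet> u) + z \<bullet> u"
    by (simp add: sum.distrib sum_distrib_right atLeast0AtMost)
  also have "(\<Sum>i\<le>p. real (p choose i) * (- (\<sigma> * l)) ^ i) = (1 - \<sigma> * l) ^ p"
    using binomial_ring[of "- (\<sigma> * l)" 1 p] by simp
  finally show ?thesis by (simp add: inner_diff_left)
qed

lemma acx_step_contraction:
  fixes F :: "'a::euclidean_space \<Rightarrow> 'a"
  assumes B: "pairwise orthogonal B" "\<And>u. u \<in> B \<Longrightarrow> norm u = 1" "span B = UNIV"
    and m: "0 < m" and lam: "\<And>u. u \<in> B \<Longrightarrow> m \<le> lam u" "\<And>u. u \<in> B \<Longrightarrow> lam u \<le> M"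
    and F: "\<And>x u. u \<in> B \<Longrightarrow> (F x - z) \<bullet> u = (1 - lam u) * ((x - z) \<bullet> u)"
    and p: "2 \<le> p" and fix_z: "F x = x \<longleftrightarrow> x = z"
  shows "(\<Sum>u\<in>B. ((acx_step F p x - z) \<bullet> u)\<^sup>2 / lam u)
    \<le> (1 - m / M) * (\<Sum>u\<in>B. ((x - z) \<bullet> u)\<^sup>2 / lam u)"
proof (cases "x = z")
  case True
  thus ?thesis using fix_z by (simp add: acx_step_def)
next
  case False
  define c where "c u = (x - z) \<bullet> u" for u
  \<comment> \<open>The contribution of \<open>u\<close> to the squared error in the norm of the
    inverse matrix.\<close>
  define w where "w u = (c u)\<^sup>2 / lam u" for u
  define \<sigma> where "\<sigma> = acx_steplength F p x"
  have lam0: "0 < lam u" if "u \<in> B" for u using lam(1)[OF that] m by simp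
  have fin: "finite B" by (rule pairwise_orthogonal_imp_finite[OF B(1)])
  have w0: "0 \<le> w u" if "u \<in> B" for u using lam0[OF that] by (simp add: w_def)
  have "\<exists>u\<in>B. c u \<noteq> 0"
  proof (rule ccontr)
    assume "\<not> ?thesis"
    hence "(x - z) \<bullet> (x - z) = 0"
      by (subst inner_orthonormal_basis[OF B]) (auto simp: c_def)
    with False show False by simp
  qed
  then obtain v where v: "v \<in> B" "c v \<noteq> 0" by blast
  have pos: "0 < (\<Sum>u\<in>B. w u * lam u ^ (2 * p + 1))"
  proof (rule sum_pos2[OF fin v(1)])
    show "0 < w v * lam v ^ (2 * p + 1)" using v lam0[OF v(1)] by (simp add: w_def)
  qed (use w0 lam0 in \<open>simp add: less_imp_le\<close>)
  \<comment> \<open>Since \<open>p \<ge> 2\<close>, both \<open>p\<close> and \<open>p - 1\<close>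
    are positive orders, as the coordinate formula for differences requires.\<close>
  obtain q where q: "p = Suc (Suc q)" using p by (metis Suc_le_D numeral_2_eq_2 Suc_le_mono)
  have D: "Delta F (Suc i) x \<bullet> u = (- lam u) ^ Suc i * c u" if "u \<in> B" for i u
    unfolding c_def by (rule Delta_inner_eigenvector) (rule F[OF that])
  have inner_B: "y \<bullet> y' = (\<Sum>u\<in>B. (y \<bullet> u) * (y' \<bullet> u))" for y y'
    by (rule inner_orthonormal_basis[OF B])
  \<comment> \<open>As \<open>(c u)\<^sup>2 = w u * lam u\<close>, passing to the weights raises the
    exponent by one: \<open>2 * p - 1\<close> becomes \<open>2 * p\<close>. The odd power leaves a
    minus sign, which the absolute value in the step length removes.\<close>
  have pw1: "(- lam u) ^ Suc (Suc q) * c u * ((- lam u) ^ Suc q * c u)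
      = - (w u * lam u ^ (2 * Suc (Suc q)))" if "u \<in> B" for u
    using lam0[OF that]
    by (simp add: w_def power_mult power2_eq_square mult_ac flip: power_mult_distrib)
  have pw2: "(- lam u) ^ Suc (Suc q) * c u * ((- lam u) ^ Suc (Suc q) * c u)
      = w u * lam u ^ (2 * Suc (Suc q) + 1)" if "u \<in> B" for u
    using lam0[OF that]
    by (simp add: w_def power_mult power2_eq_square mult_ac flip: power_mult_distrib)
  have "Delta F p x \<bullet> Delta F (p - 1) x = (\<Sum>u\<in>B. - (w u * lam u ^ (2 * p)))"
    unfolding q diff_Suc_1
    by (subst inner_B, rule sum.cong) (simp_all only: D pw1)
  moreover have "(norm (Delta F p x))\<^sup>2 = (\<Sum>u\<in>B. w u * lam u ^ (2 * p + 1))"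
    unfolding q power2_norm_eq_inner
    by (subst inner_B, rule sum.cong) (simp_all only: D pw2)
  moreover have "0 \<le> (\<Sum>u\<in>B. w u * lam u ^ (2 * p))"
    by (intro sum_nonneg mult_nonneg_nonneg w0 zero_le_power) (use lam0 in \<open>auto simp: less_imp_le\<close>)
  ultimately have \<sigma>: "\<sigma> = (\<Sum>u\<in>B. w u * lam u ^ (2 * p)) /
      (\<Sum>u\<in>B. w u * lam u ^ (2 * p + 1))"
    by (simp add: \<sigma>_def acx_steplength_def sum_negf)
  have "(acx_step F p x - z) \<bullet> u = (1 - \<sigma> * lam u) ^ p * c u" if "u \<in> B" for u
    using Delta_sum_inner_eigenvector[where F = F and z = z and u = u, OF F[OF that]] False fix_z
    by (simp add: acx_step_def \<sigma>_def c_def)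
  hence "(\<Sum>u\<in>B. ((acx_step F p x - z) \<bullet> u)\<^sup>2 / lam u)
      = (\<Sum>u\<in>B. w u * (1 - \<sigma> * lam u) ^ (2 * p))"
    by (intro sum.cong refl) (simp add: w_def power_mult_distrib power_mult[symmetric] mult.commute)
  also have "\<dots> \<le> (1 - m / M) * (\<Sum>u\<in>B. w u)"
    by (rule weighted_contraction[OF fin _ m w0 lam pos \<sigma>]) (use p in auto)
  finally show ?thesis by (simp add: w_def c_def)
qed

section \<open>Application to symmetric positive definite matrices\<close>

lemma sym_pos_def_invertible:
  fixes Q :: "real^'n^'n"
  assumes "sym_pos_def Q"
  shows "invertible Q"
  unfolding invertible_left_inverse matrix_left_invertible_ker
  using assms by (force simp: sym_pos_def_def)

lemma sym_pos_def_inner: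
  fixes Q :: "real^'n^'n"
  assumes "sym_pos_def Q"
  shows "(Q *v x) \<bullet> y = x \<bullet> (Q *v y)"
  using assms dot_lmul_matrix[of x Q y] transpose_matrix_vector[of Q x] by (simp add: sym_pos_def_def)

theorem theorem1:
  fixes Q :: "real^'n^'n" and b xstar x0 :: "real^'n"
    and F :: "real^'n \<Rightarrow> real^'n" and ps :: "nat list"
  assumes "sym_pos_def Q"
    and "F = (\<lambda>x. x - (Q *v x - b))"
    and "xstar = matrix_inv Q *v b"
    and "length ps \<ge> 1"
    and "\<forall>p\<in>set ps. p \<ge> 2"
  shows "(\<forall>x. F x = x \<longleftrightarrow> x = xstar) \<and>
    (\<exists>r. 0 \<le> r \<and> r < 1 \<and>
      (\<forall>k. inv_norm Q (acx F ps x0 (Suc k) - xstar) \<le> r * inv_norm Q (acx F ps x0 k - xstar)))"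
proof -
  note inv = sym_pos_def_invertible[OF assms(1)]
  note adj = sym_pos_def_inner[OF assms(1)]
  \<comment> \<open>\<open>matrix_inv\<close> is defined by choice, so invertibility is what makes
    it a two-sided inverse.\<close>
  have "Q ** matrix_inv Q = mat 1 \<and> matrix_inv Q ** Q = mat 1"
    using inv unfolding invertible_def matrix_inv_def by (rule someI_ex)
  hence QI: "Q *v (matrix_inv Q *v y) = y" "matrix_inv Q *v (Q *v y) = y" for y
    by (simp_all add: matrix_vector_mul_assoc)
  have b: "b = Q *v xstar" by (simp add: assms(3) QI)
  have fix_x: "F x = x \<longleftrightarrow> x = xstar" for x
    unfolding assms(2) b using QI(2)[of x] QI(2)[of xstar] by auto
  obtain B lam where B: "pairwise orthogonal B" "\<And>u. u \<in> B \<Longrightarrow> norm u = 1" "span B = UNIV"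
    and eig: "\<And>u. u \<in> B \<Longrightarrow> Q *v u = lam u *\<^sub>R u"
    using self_adjoint_orthonormal_eigenbasis[OF matrix_vector_mul_linear[of Q] adj] by metis
  have fin: "finite B" by (rule pairwise_orthogonal_imp_finite[OF B(1)])
  have lam0: "0 < lam u" if "u \<in> B" for u
  proof -
    have "u \<noteq> 0" using B(2)[OF that] by auto
    hence "0 < u \<bullet> (Q *v u)" using assms(1) by (simp add: sym_pos_def_def)
    thus ?thesis using B(2)[OF that] by (simp add: eig[OF that] norm_eq_1)
  qed
  \<comment> \<open>Nonemptiness makes \<open>Min\<close> and \<open>Max\<close> of the eigenvalues
    meaningful; it holds because the index type is inhabited.\<close>
  have "B \<noteq> {}"
  proof
    assume "B = {}"
    with B(3) have "(UNIV :: (real^'n) set) = {0}" by simp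
    hence "(axis undefined 1 :: real^'n) = 0" by blast
    thus False by (simp add: axis_eq_0_iff)
  qed
  define m where "m = Min (lam ` B)"
  define M where "M = Max (lam ` B)"
  have m: "0 < m" using fin \<open>B \<noteq> {}\<close> lam0 by (simp add: m_def)
  have mM: "m \<le> lam u" "lam u \<le> M" if "u \<in> B" for u
    using fin that by (auto simp: m_def M_def)
  have "m \<le> M" using mM \<open>B \<noteq> {}\<close> by fastforce
  have F: "(F x - xstar) \<bullet> u = (1 - lam u) * ((x - xstar) \<bullet> u)" if "u \<in> B" for x u
    by (simp add: assms(2) b inner_diff_left adj eig[OF that] algebra_simps)
  \<comment> \<open>The inverse matrix acts on \<open>u\<close> as \<open>1 / lam u\<close>, so the
    norm is diagonal in the same basis.\<close>
  have norm: "inv_norm Q y = sqrt (\<Sum>u\<in>B. (y \<bullet> u)\<^sup>2 / lam u)" for y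
  proof -
    have "y \<bullet> u = lam u * ((matrix_inv Q *v y) \<bullet> u)" if "u \<in> B" for u
      using adj[of "matrix_inv Q *v y" u] by (simp add: QI eig[OF that])
    hence "(matrix_inv Q *v y) \<bullet> u = (y \<bullet> u) / lam u" if "u \<in> B" for u
      using that lam0[OF that] by simp
    hence "y \<bullet> (matrix_inv Q *v y) = (\<Sum>u\<in>B. (y \<bullet> u)\<^sup>2 / lam u)"
      by (simp add: inner_orthonormal_basis[OF B, of y "matrix_inv Q *v y"] power2_eq_square)
    thus ?thesis by (simp only: inv_norm_def)
  qed
  \<comment> \<open>The square root arises because the contraction is proved for squared norms. The
    rate depends only on the extreme eigenvalues, not on \<open>k\<close>, \<open>ps\<close> or
    \<open>x0\<close>.\<close>
  define r where "r = sqrt (1 - m / M)"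
  have "inv_norm Q (acx F ps x0 (Suc k) - xstar) \<le> r * inv_norm Q (acx F ps x0 k - xstar)" for k
  proof -
    have "ps ! (k mod length ps) \<in> set ps" using assms(4) by (intro nth_mem mod_less_divisor) linarith
    hence "2 \<le> ps ! (k mod length ps)" using assms(5) by blast
    from acx_step_contraction[OF B m mM F this fix_x]
    show ?thesis unfolding norm r_def real_sqrt_mult[symmetric] by simp
  qed
  moreover have "0 \<le> r" "r < 1" using m \<open>m \<le> M\<close> by (auto simp: r_def)
  ultimately show ?thesis using fix_x by blast
qed

end
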